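(* Let $d\ge1$ and let $\mathbf n=(n_1,\dots,n_d)$ be a tuple of positive integers. The ideal $I_1$ is theta-$1$ exact, i.e. $\mathrm{TH}_1(I_1)=\overline{\mathrm{conv}(\mathcal V_{\mathbb R}(I_1))}$.
   Context: $[\mathbf n]=[n_1]\times\cdots\times[n_d]$ with $[m]=\{1,\dots,m\}$; $\mathbb R[X]$ is the polynomial ring in the variables $x_a$, $a\in[\mathbf n]$, and $I_1=\langle x_a^3-x_a\ (a\in[\mathbf n]),\ x_ax_b\ (a\ne b),\ \sum_{a}x_a^2-1\rangle$. $\mathcal V_{\mathbb R}(I)$ denotes the real zero set of $I$ in $\mathbb R^{n_1\times\cdots\times n_d}$. Theta bodies. For an ideal $I$ in $\mathbb R[X]$, $\deg(f+I)=\min\{\deg h: h\equiv f \bmod I\}$; $V_j=\{f+I:\deg(f+I)\le j\}$; $\Sigma_k(I)\subset V_{2k}$ is the set of classes $\sum_i h_i^2+I$ of finite sums of squares of polynomials with $\deg h_i\le k$; $\Sigma_k(I)^*=\{\ell\in V_{2k}^*:\ell(s)\ge 0\ \forall s\in\Sigma_k(I)\}$, where $V_{2k}^*$ is the space of linear functionals on $V_{2k}$. The theta-$k$ body of $I$ is $\mathrm{TH}_k(I)=\mathrm{cl}\{(\ell(x_a+I))_{a}:\ \ell\in\Sigma_k(I)^*,\ \ell(1+I)=1\}$. *)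

theory Defs
  imports "HOL-Analysis.Analysis" "HOL-Analysis.Finite_Function_Topology" "HOL-Algebra.Ideal"
begin

text \<open>
  A polynomial is a finitely supported map from monomials to coefficients, a monomial being a
  finitely supported map from variables to exponents. The variables range over a whole type
  \<open>'v\<close>; \<open>mpoly_ring A\<close> is the ring of those polynomials that only involve
  variables from the set \<open>A\<close>.
\<close>

type_synonym 'v mpoly = "('v \<Rightarrow>\<^sub>0 nat) \<Rightarrow>\<^sub>0 real"

definition mpoly_ring :: "'v set \<Rightarrow> 'v mpoly ring"
  where "mpoly_ring A =
    \<lparr>carrier = {p. \<forall>m \<in> Poly_Mapping.keys p. Poly_Mapping.keys m \<subseteq> A},
     mult = (*), one = 1, zero = 0, add = (+)\<rparr>"

definition Var :: "'v \<Rightarrow> 'v mpoly"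
  where "Var a = Poly_Mapping.single (Poly_Mapping.single a 1) 1"

definition mdegree :: "('v \<Rightarrow>\<^sub>0 nat) \<Rightarrow> nat"
  where "mdegree m = (\<Sum>a \<in> Poly_Mapping.keys m. Poly_Mapping.lookup m a)"

text \<open>Total degree; the zero polynomial gets degree 0.\<close>

definition tdegree :: "'v mpoly \<Rightarrow> nat"
  where "tdegree p = Max (insert 0 (mdegree ` Poly_Mapping.keys p))"

definition mpoly_eval :: "('v \<Rightarrow>\<^sub>0 real) \<Rightarrow> 'v mpoly \<Rightarrow> real"
  where "mpoly_eval x p =
    (\<Sum>m \<in> Poly_Mapping.keys p. Poly_Mapping.lookup p m *
       (\<Prod>a \<in> Poly_Mapping.keys m. Poly_Mapping.lookup x a ^ Poly_Mapping.lookup m a))"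

text \<open>
  For finite \<open>A\<close>, the points of \<open>\<real>\<^sup>A\<close> are the finitely supported functions whose support lies in
  \<open>A\<close>. They form a closed, finite-dimensional subspace of the normed space
  \<open>'v \<Rightarrow>\<^sub>0 real\<close>, so \<open>closure\<close> and \<open>convex hull\<close> taken in that type agree with those in
  \<open>\<real>\<^sup>A\<close>.
\<close>

definition points :: "'v set \<Rightarrow> ('v \<Rightarrow>\<^sub>0 real) set"
  where "points A = {x. Poly_Mapping.keys x \<subseteq> A}"

definition real_variety :: "'v set \<Rightarrow> 'v mpoly set \<Rightarrow> ('v \<Rightarrow>\<^sub>0 real) set"
  where "real_variety A I = {x \<in> points A. \<forall>f \<in> I. mpoly_eval x f = 0}"

definition residue_class :: "'v set \<Rightarrow> 'v mpoly set \<Rightarrow> 'v mpoly \<Rightarrow> 'v mpoly set"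
  where "residue_class A I f = I +>\<^bsub>mpoly_ring A\<^esub> f"

text \<open>The degree of a class is the least degree of a representative.\<close>

definition class_degree :: "'v mpoly set \<Rightarrow> nat"
  where "class_degree C = Inf (tdegree ` C)"

definition classes_upto :: "'v set \<Rightarrow> 'v mpoly set \<Rightarrow> nat \<Rightarrow> 'v mpoly set set"
  where "classes_upto A I j =
    {residue_class A I f | f. f \<in> carrier (mpoly_ring A) \<and>
       class_degree (residue_class A I f) \<le> j}"

definition sos_classes :: "'v set \<Rightarrow> 'v mpoly set \<Rightarrow> nat \<Rightarrow> 'v mpoly set set"
  where "sos_classes A I k =
    {residue_class A I (\<Sum>i<N. h i ^ 2) | (N :: nat) h.
       \<forall>i<N. h i \<in> carrier (mpoly_ring A) \<and> tdegree (h i) \<le> k}"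

text \<open>
  Linear functionals on the space of classes of degree at most \<open>j\<close>. They are represented by
  functions on arbitrary sets of polynomials, of which only the values on that space matter.
\<close>

definition class_functional ::
    "'v set \<Rightarrow> 'v mpoly set \<Rightarrow> nat \<Rightarrow> ('v mpoly set \<Rightarrow> real) \<Rightarrow> bool"
  where "class_functional A I j l \<longleftrightarrow>
    (\<forall>f \<in> carrier (mpoly_ring A). \<forall>g \<in> carrier (mpoly_ring A).
       residue_class A I f \<in> classes_upto A I j \<longrightarrow> residue_class A I g \<in> classes_upto A I j \<longrightarrow>
       l (residue_class A I (f + g)) = l (residue_class A I f) + l (residue_class A I g)) \<and>
    (\<forall>c. \<forall>f \<in> carrier (mpoly_ring A).
       residue_class A I f \<in> classes_upto A I j \<longrightarrow>
       l (residue_class A I (c *\<^sub>R f)) = c * l (residue_class A I f))"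

definition sos_dual ::
    "'v set \<Rightarrow> 'v mpoly set \<Rightarrow> nat \<Rightarrow> ('v mpoly set \<Rightarrow> real) set"
  where "sos_dual A I k =
    {l. class_functional A I (2 * k) l \<and> (\<forall>s \<in> sos_classes A I k. 0 \<le> l s)}"

text \<open>Meaningful for \<open>k \<ge> 1\<close>, when the classes of the variables lie in the domain of the functionals.\<close>

definition theta_body :: "'v set \<Rightarrow> 'v mpoly set \<Rightarrow> nat \<Rightarrow> ('v \<Rightarrow>\<^sub>0 real) set"
  where "theta_body A I k =
    closure {y \<in> points A. \<exists>l \<in> sos_dual A I k. l (residue_class A I 1) = 1 \<and>
       (\<forall>a \<in> A. Poly_Mapping.lookup y a = l (residue_class A I (Var a)))}"

definition theta_exact :: "'v set \<Rightarrow> 'v mpoly set \<Rightarrow> nat \<Rightarrow> bool"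
  where "theta_exact A I k \<longleftrightarrow> theta_body A I k = closure (convex hull (real_variety A I))"

text \<open>The index set \<open>[n\<^sub>1] \<times> \<dots> \<times> [n\<^sub>d]\<close>, as a set of lists of length \<open>d\<close>.\<close>

definition tensor_index :: "nat list \<Rightarrow> nat list set"
  where "tensor_index ns = listset (map (\<lambda>m. {1..m}) ns)"

definition I1 :: "nat list \<Rightarrow> nat list mpoly set"
  where "I1 ns = Idl\<^bsub>mpoly_ring (tensor_index ns)\<^esub>
    ({Var a ^ 3 - Var a | a. a \<in> tensor_index ns} \<union>
     {Var a * Var b | a b. a \<in> tensor_index ns \<and> b \<in> tensor_index ns \<and> a \<noteq> b} \<union>
     {(\<Sum>a \<in> tensor_index ns. Var a ^ 2) - 1})"

end

theory Submission
  imports Defs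
begin

text \<open>
  Let \<open>A\<close> be any finite nonempty set of variables, such as the index set of a tensor. The generators say that exactly one coordinate of a point of the variety
  is nonzero and that it is \<open>1\<close> or \<open>-1\<close>; the variety therefore contains the signed unit vectors,
  whose convex hull is the cross-polytope \<open>\<Sum>a\<in>A. \<bar>y a\<bar> \<le> 1\<close>.

  Theta exactness comes from a single congruence. For signs \<open>s a \<in> {1, -1}\<close> put
  \<open>L = (\<Sum>a\<in>A. s a * x a)\<close>. The mixed products in \<open>L\<^sup>2\<close> lie in the ideal, and what is left is
  \<open>\<Sum>a\<in>A. (x a)\<^sup>2\<close>, so \<open>L\<^sup>2 \<equiv> 1\<close> and hence \<open>(1 - L)\<^sup>2 = 1 - 2 * L + L\<^sup>2 \<equiv> 2 * (1 - L)\<close>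
  (\<open>one_minus_signed_sum_square_congruence\<close>). Thus, modulo the ideal, every facet inequality
  \<open>1 - L \<ge> 0\<close> of the cross-polytope is, up to a factor two, the square of a polynomial of degree
  at most one. A normalised functional that is nonnegative on such squares takes values
  \<open>y a\<close> on the variables with \<open>\<Sum>a\<in>A. s a * y a \<le> 1\<close>; choosing \<open>s a\<close> as the sign of \<open>y a\<close> puts
  \<open>y\<close> in the cross-polytope (\<open>theta_points_subset_cross_polytope\<close>).

  The other inclusion holds for every ideal and every \<open>k\<close>: evaluation at a point of the variety is an
  admissible functional, and admissible functionals form a convex set
  (\<open>real_variety_subset_theta_points\<close>, \<open>convex_theta_points\<close>). Both inclusions hold before closures
  are taken, so the closures agree.
\<close>

section \<open>The polynomial ring\<close>

abbreviation lookup where "lookup \<equiv> Poly_Mapping.lookup"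
abbreviation keys where "keys \<equiv> Poly_Mapping.keys"
abbreviation single where "single \<equiv> Poly_Mapping.single"

lemma lookup_scaleR: "lookup (c *\<^sub>R p) m = c *\<^sub>R lookup p m"
proof -
  have "finite {i. c *\<^sub>R lookup p i \<noteq> 0}"
    by (rule finite_subset[OF _ finite_keys[of p]]) (auto simp: in_keys_iff)
  then show ?thesis by (simp add: scaleR_poly_mapping_def)
qed

lemma keys_scaleR: "keys (c *\<^sub>R p) \<subseteq> keys p"
  by (auto simp: in_keys_iff lookup_scaleR)

lemma single_scaleR: "c *\<^sub>R single m b = single m (c *\<^sub>R b)"
  by (rule poly_mapping_eqI) (simp add: lookup_scaleR lookup_single when_def)

text \<open>
  Splits a polynomial into single terms, so that an identity that is additive in the polynomial need
  only be checked on terms.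
\<close>

lemma poly_mapping_additive_induct [case_names zero single add]:
  assumes "P 0" "\<And>m c. P (single m c)" "\<And>f g. P f \<Longrightarrow> P g \<Longrightarrow> P (f + g)"
  shows "P (f :: 'a \<Rightarrow>\<^sub>0 'b::comm_monoid_add)"
proof (induction f rule: update_induct)
  case const
  show ?case by (rule assms)
next
  case (update f a b)
  have "Poly_Mapping.update a b f = single a b + f"
    using update(1) by (intro poly_mapping_eqI)
      (auto simp: lookup_update lookup_add lookup_single when_def in_keys_iff)
  then show ?case using assms update by metis
qed

text \<open>
  Scaling is multiplication by a constant polynomial, so closure under multiplication by ring
  elements (of the carrier, of an ideal) also yields closure under scaling.
\<close>

lemma scaleR_eq_mult: "c *\<^sub>R p = single 0 c * (p :: 'v mpoly)"
proof (induction p rule: poly_mapping_additive_induct)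
  case (add f g)
  then show ?case by (simp add: scaleR_add_right distrib_left)
qed (simp_all add: single_scaleR mult_single)

lemma mpoly_ring_simps [simp]:
  "mult (mpoly_ring A) = (*)" "one (mpoly_ring A) = 1"
  "zero (mpoly_ring A) = 0" "add (mpoly_ring A) = (+)"
  by (simp_all add: mpoly_ring_def)

lemma carrier_iff: "f \<in> carrier (mpoly_ring A) \<longleftrightarrow> (\<forall>m\<in>keys f. keys m \<subseteq> A)"
  by (simp add: mpoly_ring_def)

lemma carrier_closed [simp, intro]:
  shows "0 \<in> carrier (mpoly_ring A)" "1 \<in> carrier (mpoly_ring A)"
    and "single 0 c \<in> carrier (mpoly_ring A)"
    and "a \<in> A \<Longrightarrow> Var a \<in> carrier (mpoly_ring A)"
  by (auto simp: carrier_iff Var_def)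

lemma carrier_add [intro]:
  assumes "f \<in> carrier (mpoly_ring A)" "g \<in> carrier (mpoly_ring A)"
  shows "f + g \<in> carrier (mpoly_ring A)"
  using assms keys_add[of f g] by (fastforce simp: carrier_iff)

lemma carrier_mult [intro]:
  assumes "f \<in> carrier (mpoly_ring A)" "g \<in> carrier (mpoly_ring A)"
  shows "f * g \<in> carrier (mpoly_ring A)"
  unfolding carrier_iff
proof
  fix m assume "m \<in> keys (f * g)"
  then obtain a b where "m = a + b" "a \<in> keys f" "b \<in> keys g" using keys_mult by blast
  then show "keys m \<subseteq> A" using assms keys_add[of a b] unfolding carrier_iff by blast
qed

lemma carrier_scaleR [intro]:
  "f \<in> carrier (mpoly_ring A) \<Longrightarrow> c *\<^sub>R f \<in> carrier (mpoly_ring A)"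
  by (auto simp: scaleR_eq_mult)

lemma carrier_uminus [intro]:
  "f \<in> carrier (mpoly_ring A) \<Longrightarrow> - f \<in> carrier (mpoly_ring A)"
  using carrier_scaleR[of f A "-1"] by simp

lemma carrier_diff [intro]:
  "f \<in> carrier (mpoly_ring A) \<Longrightarrow> g \<in> carrier (mpoly_ring A) \<Longrightarrow> f - g \<in> carrier (mpoly_ring A)"
  using carrier_add[of f A "- g"] by auto

lemma carrier_power [intro]:
  "f \<in> carrier (mpoly_ring A) \<Longrightarrow> f ^ n \<in> carrier (mpoly_ring A)"
  by (induction n) auto

lemma carrier_sum [intro]:
  "(\<And>i. i \<in> S \<Longrightarrow> f i \<in> carrier (mpoly_ring A)) \<Longrightarrow> sum f S \<in> carrier (mpoly_ring A)"
  by (induction S rule: infinite_finite_induct) auto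

lemma ring_mpoly_ring: "ring (mpoly_ring A)"
proof (rule ringI)
  show "abelian_group (mpoly_ring A)"
  proof (rule abelian_groupI)
    fix x assume "x \<in> carrier (mpoly_ring A)"
    then show "\<exists>y\<in>carrier (mpoly_ring A). y \<oplus>\<^bsub>mpoly_ring A\<^esub> x = \<zero>\<^bsub>mpoly_ring A\<^esub>"
      by (intro bexI[of _ "- x"]) auto
  qed (auto simp: algebra_simps)
  show "monoid (mpoly_ring A)"
    by (rule monoidI) (auto simp: algebra_simps)
qed (auto simp: algebra_simps)

lemma a_inv_mpoly_ring:
  assumes "f \<in> carrier (mpoly_ring A)"
  shows "\<ominus>\<^bsub>mpoly_ring A\<^esub> f = - f"
proof -
  interpret ring "mpoly_ring A" by (rule ring_mpoly_ring)
  show ?thesis using minus_equality[of "- f" f] assms by auto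
qed

section \<open>Ideals and residue classes\<close>

context
  fixes A :: "'v set" and I :: "'v mpoly set"
  assumes I: "ideal I (mpoly_ring A)"
begin

interpretation ideal I "mpoly_ring A" by (rule I)

lemma ideal_zero: "0 \<in> I"
  using additive_subgroup.zero_closed[OF additive_subgroup_axioms] by simp

lemma ideal_add: "f \<in> I \<Longrightarrow> g \<in> I \<Longrightarrow> f + g \<in> I"
  using additive_subgroup.a_closed[OF additive_subgroup_axioms] by simp

lemma ideal_mult: "f \<in> I \<Longrightarrow> h \<in> carrier (mpoly_ring A) \<Longrightarrow> h * f \<in> I"
  using I_l_closed by simp

lemma ideal_scaleR: "f \<in> I \<Longrightarrow> c *\<^sub>R f \<in> I"
  by (auto simp: scaleR_eq_mult intro: ideal_mult)

lemma ideal_diff: "f \<in> I \<Longrightarrow> g \<in> I \<Longrightarrow> f - g \<in> I"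
  using ideal_add[of f "- g"] ideal_scaleR[of g "-1"] by simp

lemma ideal_sum: "(\<And>i. i \<in> S \<Longrightarrow> f i \<in> I) \<Longrightarrow> sum f S \<in> I"
  by (induction S rule: infinite_finite_induct) (auto intro: ideal_add ideal_zero)

lemma residue_class_eq_image: "residue_class A I f = (\<lambda>i. i + f) ` I"
  by (auto simp: residue_class_def a_r_coset_def r_coset_def)

lemma mem_residue_class_iff: "g \<in> residue_class A I f \<longleftrightarrow> g - f \<in> I"
  by (force simp: residue_class_eq_image image_iff algebra_simps)

lemma residue_class_eqI:
  assumes "f - g \<in> I"
  shows "residue_class A I f = residue_class A I g"
proof (rule Set.set_eqI)
  fix h
  have "h - f = (h - g) - (f - g)" "h - g = (h - f) + (f - g)" by simp_all
  then show "h \<in> residue_class A I f \<longleftrightarrow> h \<in> residue_class A I g"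
    using assms ideal_add ideal_diff by (metis mem_residue_class_iff)
qed

text \<open>The degree of a class is bounded by that of any representative, as it is a minimum over them.\<close>

lemma residue_class_in_classes_upto:
  assumes "f \<in> carrier (mpoly_ring A)" "tdegree f \<le> j"
  shows "residue_class A I f \<in> classes_upto A I j"
proof -
  have "f \<in> residue_class A I f" by (simp add: mem_residue_class_iff ideal_zero)
  then have "class_degree (residue_class A I f) \<le> tdegree f"
    unfolding class_degree_def by (intro cInf_lower) auto
  then show ?thesis using assms unfolding classes_upto_def by force
qed

end

section \<open>Evaluation\<close>

definition monomial_eval :: "('v \<Rightarrow>\<^sub>0 real) \<Rightarrow> ('v \<Rightarrow>\<^sub>0 nat) \<Rightarrow> real"
  where "monomial_eval x m = (\<Prod>a\<in>keys m. lookup x a ^ lookup m a)"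

text \<open>
  The support of a sum or product may be smaller than the union of the supports. Evaluating over a
  common superset lets two expressions be compared term by term; the extra factors are \<open>1\<close>, and
  for polynomials the extra summands are \<open>0\<close>.
\<close>

lemma monomial_eval_superset:
  "finite K \<Longrightarrow> keys m \<subseteq> K \<Longrightarrow> monomial_eval x m = (\<Prod>a\<in>K. lookup x a ^ lookup m a)"
  unfolding monomial_eval_def by (rule prod.mono_neutral_left) (auto simp: in_keys_iff)

lemma monomial_eval_add: "monomial_eval x (m + n) = monomial_eval x m * monomial_eval x n"
  using keys_add[of m n]
  by (simp add: monomial_eval_superset[of "keys m \<union> keys n"] lookup_add power_add prod.distrib)

lemma mpoly_eval_superset:
  "finite K \<Longrightarrow> keys p \<subseteq> K \<Longrightarrow> mpoly_eval x p = (\<Sum>m\<in>K. lookup p m * monomial_eval x m)"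
  unfolding mpoly_eval_def monomial_eval_def[symmetric]
  by (rule sum.mono_neutral_left) (auto simp: in_keys_iff)

lemma mpoly_eval_add: "mpoly_eval x (p + q) = mpoly_eval x p + mpoly_eval x q"
  using keys_add[of p q]
  by (simp add: mpoly_eval_superset[of "keys p \<union> keys q"] lookup_add distrib_right sum.distrib)

lemma mpoly_eval_0: "mpoly_eval x 0 = 0"
  by (simp add: mpoly_eval_def)

lemma mpoly_eval_single: "mpoly_eval x (single m c) = c * monomial_eval x m"
  by (simp add: mpoly_eval_superset[of "{m}"])

lemma mpoly_eval_mult: "mpoly_eval x (p * q) = mpoly_eval x p * mpoly_eval x q"
proof (induction p rule: poly_mapping_additive_induct)
  case (single m c)
  show ?case
    by (induction q rule: poly_mapping_additive_induct)
      (simp_all add: mpoly_eval_0 mpoly_eval_add mpoly_eval_single mult_single monomial_eval_add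
        distrib_left)
qed (simp_all add: mpoly_eval_0 mpoly_eval_add distrib_right)

lemma mpoly_eval_scaleR: "mpoly_eval x (c *\<^sub>R p) = c * mpoly_eval x p"
  by (simp add: scaleR_eq_mult mpoly_eval_mult mpoly_eval_single monomial_eval_def)

lemma mpoly_eval_uminus: "mpoly_eval x (- p) = - mpoly_eval x p"
  using mpoly_eval_scaleR[of x "-1" p] by simp

lemma mpoly_eval_diff: "mpoly_eval x (p - q) = mpoly_eval x p - mpoly_eval x q"
  using mpoly_eval_add[of x p "- q"] by (simp add: mpoly_eval_uminus)

lemma mpoly_eval_1: "mpoly_eval x 1 = 1"
  using mpoly_eval_single[of x 0 1] by (simp add: monomial_eval_def)

lemma mpoly_eval_power: "mpoly_eval x (p ^ n) = mpoly_eval x p ^ n"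
  by (induction n) (simp_all add: mpoly_eval_1 mpoly_eval_mult)

lemma mpoly_eval_sum: "mpoly_eval x (sum f S) = (\<Sum>i\<in>S. mpoly_eval x (f i))"
  by (induction S rule: infinite_finite_induct) (simp_all add: mpoly_eval_0 mpoly_eval_add)

lemma mpoly_eval_Var: "mpoly_eval x (Var a) = lookup x a"
  by (simp add: Var_def mpoly_eval_single monomial_eval_def)

lemmas mpoly_eval_simps = mpoly_eval_0 mpoly_eval_1 mpoly_eval_add mpoly_eval_diff mpoly_eval_mult
  mpoly_eval_uminus mpoly_eval_scaleR mpoly_eval_power mpoly_eval_sum mpoly_eval_Var

text \<open>
  The polynomials vanishing at a point form an ideal, so a point lies in the variety of a generated
  ideal as soon as the generators vanish there.
\<close>

lemma vanishing_ideal: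
  "ideal {f \<in> carrier (mpoly_ring A). mpoly_eval x f = 0} (mpoly_ring A)"
proof (rule idealI[OF ring_mpoly_ring], unfold_locales)
  interpret ring "mpoly_ring A" by (rule ring_mpoly_ring)
  fix f assume "f \<in> {f \<in> carrier (mpoly_ring A). mpoly_eval x f = 0}"
  then show "inv\<^bsub>add_monoid (mpoly_ring A)\<^esub> f \<in> {f \<in> carrier (mpoly_ring A). mpoly_eval x f = 0}"
    using a_inv_mpoly_ring[of f A] by (auto simp: mpoly_eval_simps a_inv_def)
qed (auto simp: mpoly_eval_simps)

lemma real_variety_genideal:
  assumes "G \<subseteq> carrier (mpoly_ring A)" "x \<in> points A" "\<And>g. g \<in> G \<Longrightarrow> mpoly_eval x g = 0"
  shows "x \<in> real_variety A (Idl\<^bsub>mpoly_ring A\<^esub> G)"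
  using ring.genideal_minimal[OF ring_mpoly_ring vanishing_ideal[of A x], of G] assms
  by (auto simp: real_variety_def)

section \<open>Degrees\<close>

lemma tdegree_le_iff: "tdegree p \<le> j \<longleftrightarrow> (\<forall>m\<in>keys p. mdegree m \<le> j)"
  by (simp add: tdegree_def)

lemma tdegree_add_le: "tdegree p \<le> j \<Longrightarrow> tdegree q \<le> j \<Longrightarrow> tdegree (p + q) \<le> j"
  using keys_add[of p q] by (fastforce simp: tdegree_le_iff)

lemma tdegree_scaleR_le: "tdegree p \<le> j \<Longrightarrow> tdegree (c *\<^sub>R p) \<le> j"
  using keys_scaleR[of c p] by (auto simp: tdegree_le_iff)

lemma tdegree_0: "tdegree 0 = 0"
  by (simp add: tdegree_def)

lemma tdegree_sum_le: "(\<And>i. i \<in> S \<Longrightarrow> tdegree (f i) \<le> j) \<Longrightarrow> tdegree (sum f S) \<le> j"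
  by (induction S rule: infinite_finite_induct) (auto intro: tdegree_add_le simp: tdegree_0)

lemma tdegree_1: "tdegree 1 = 0"
  by (simp add: tdegree_def mdegree_def)

lemma tdegree_Var: "tdegree (Var a) = 1"
  by (simp add: tdegree_def mdegree_def Var_def)

section \<open>Theta bodies contain the convex hull of the variety\<close>

text \<open>
  Named apart from its closure because convexity and both inclusions are already true of this set.
\<close>

definition theta_points :: "'v set \<Rightarrow> 'v mpoly set \<Rightarrow> nat \<Rightarrow> ('v \<Rightarrow>\<^sub>0 real) set"
  where "theta_points A I k =
    {y \<in> points A. \<exists>l \<in> sos_dual A I k. l (residue_class A I 1) = 1 \<and>
       (\<forall>a \<in> A. lookup y a = l (residue_class A I (Var a)))}"

lemma theta_body_eq_closure: "theta_body A I k = closure (theta_points A I k)"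
  by (simp add: theta_body_def theta_points_def)

text \<open>
  The functional is defined on classes through an arbitrary representative. At a point of the variety
  the choice does not affect the value, because representatives differ by elements of the ideal.
\<close>

definition eval_functional :: "('v \<Rightarrow>\<^sub>0 real) \<Rightarrow> 'v mpoly set \<Rightarrow> real"
  where "eval_functional x C = mpoly_eval x (SOME f. f \<in> C)"

lemma eval_functional_residue_class:
  assumes "ideal I (mpoly_ring A)" "x \<in> real_variety A I"
  shows "eval_functional x (residue_class A I f) = mpoly_eval x f"
proof -
  have "f \<in> residue_class A I f"
    by (simp add: mem_residue_class_iff[OF assms(1)] ideal_zero[OF assms(1)])
  then have "(SOME g. g \<in> residue_class A I f) \<in> residue_class A I f" by (rule someI)
  then have "mpoly_eval x ((SOME g. g \<in> residue_class A I f) - f) = 0"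
    using assms by (simp add: mem_residue_class_iff real_variety_def)
  then show ?thesis by (simp add: eval_functional_def mpoly_eval_diff)
qed

text \<open>Evaluation is linear, sends \<open>1\<close> to \<open>1\<close> and sends a sum of squares to a sum of squares of reals.\<close>

lemma real_variety_subset_theta_points:
  assumes I: "ideal I (mpoly_ring A)"
  shows "real_variety A I \<subseteq> theta_points A I k"
proof
  fix x assume x: "x \<in> real_variety A I"
  note ev = eval_functional_residue_class[OF I x]
  have "eval_functional x \<in> sos_dual A I k"
    by (auto simp: sos_dual_def class_functional_def sos_classes_def ev mpoly_eval_simps sum_nonneg)
  then show "x \<in> theta_points A I k"
    using x unfolding theta_points_def real_variety_def
    by (auto intro!: bexI[of _ "eval_functional x"] simp: ev mpoly_eval_simps)
qed

text \<open>
  All conditions on a functional are linear equations and inequalities in it, so the functionals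
  belonging to two points can be combined with the same weights as the points.
\<close>

lemma convex_theta_points: "convex (theta_points A I k)"
proof (rule convexI)
  fix y z :: "'a \<Rightarrow>\<^sub>0 real" and u v :: real
  assume y: "y \<in> theta_points A I k" and z: "z \<in> theta_points A I k"
    and uv: "0 \<le> u" "0 \<le> v" "u + v = 1"
  obtain l where l: "l \<in> sos_dual A I k" "l (residue_class A I 1) = 1"
    "\<And>a. a \<in> A \<Longrightarrow> lookup y a = l (residue_class A I (Var a))"
    using y by (auto simp: theta_points_def)
  obtain m where m: "m \<in> sos_dual A I k" "m (residue_class A I 1) = 1"
    "\<And>a. a \<in> A \<Longrightarrow> lookup z a = m (residue_class A I (Var a))"
    using z by (auto simp: theta_points_def)
  have "(\<lambda>C. u * l C + v * m C) \<in> sos_dual A I k"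
    using l(1) m(1) uv unfolding sos_dual_def class_functional_def
    by (simp add: algebra_simps)
  moreover have "u *\<^sub>R y + v *\<^sub>R z \<in> points A"
  proof -
    have "keys y \<subseteq> A" "keys z \<subseteq> A" using y z by (simp_all add: theta_points_def points_def)
    then show ?thesis
      using keys_add[of "u *\<^sub>R y" "v *\<^sub>R z"] keys_scaleR[of u y] keys_scaleR[of v z]
      unfolding points_def by blast
  qed
  ultimately show "u *\<^sub>R y + v *\<^sub>R z \<in> theta_points A I k"
    unfolding theta_points_def
    by (auto intro!: bexI[of _ "\<lambda>C. u * l C + v * m C"]
        simp: l m uv lookup_add lookup_scaleR)
qed

section \<open>The cross-polytope\<close>

text \<open>
  A point is the combination of the unit vectors carrying the signs of its coordinates, with the
  absolute values of the coordinates as weights. The weights may sum to less than one; the missing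
  weight goes to the origin, the midpoint of two opposite unit vectors. The origin is available only
  because \<open>A\<close> is nonempty.
\<close>

lemma cross_polytope_subset_convex_hull:
  fixes y :: "'v \<Rightarrow>\<^sub>0 real"
  assumes A: "finite A" "A \<noteq> {}" and y: "y \<in> points A" "(\<Sum>a\<in>A. \<bar>lookup y a\<bar>) \<le> 1"
    and S: "\<And>a. a \<in> A \<Longrightarrow> single a 1 \<in> S" "\<And>a. a \<in> A \<Longrightarrow> single a (-1) \<in> S"
  shows "y \<in> convex hull S"
proof -
  let ?C = "convex hull S" and ?t = "\<Sum>a\<in>A. \<bar>lookup y a\<bar>"
  define e where "e a = single a (if lookup y a < 0 then -1 else 1 :: real)" for a
  have e: "e a \<in> ?C" if "a \<in> A" for a
    using S[OF that] by (auto simp: e_def intro: hull_inc)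
  have decomp: "y = (\<Sum>a\<in>A. \<bar>lookup y a\<bar> *\<^sub>R e a)"
  proof (rule poly_mapping_eqI)
    fix b
    have "lookup (\<Sum>a\<in>A. \<bar>lookup y a\<bar> *\<^sub>R e a) b = (\<Sum>a\<in>A. if a = b then lookup y b else 0)"
      by (auto simp: lookup_sum lookup_scaleR e_def lookup_single when_def intro!: sum.cong)
    then show "lookup y b = lookup (\<Sum>a\<in>A. \<bar>lookup y a\<bar> *\<^sub>R e a) b"
      using A y by (auto simp: points_def in_keys_iff)
  qed
  obtain a where a: "a \<in> A" using A by blast
  have "(1/2) *\<^sub>R single a (1::real) + (1/2) *\<^sub>R single a (-1) \<in> ?C"
    using S[OF a] by (intro convexD[OF convex_convex_hull] hull_inc) auto
  then have zero: "0 \<in> ?C"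
    by (simp add: single_scaleR flip: single_add)
  have t0: "0 \<le> ?t" by (simp add: sum_nonneg)
  show ?thesis
  proof (cases "?t = 0")
    case True
    then have "lookup y a = 0" if "a \<in> A" for a
      using that A by (simp add: sum_nonneg_eq_0_iff)
    then have "y = 0" using decomp by simp
    then show ?thesis using zero by simp
  next
    case False
    have "(\<Sum>a\<in>A. (\<bar>lookup y a\<bar> / ?t) *\<^sub>R e a) \<in> ?C"
      using A False e by (intro convex_sum) (auto simp: sum_nonneg simp flip: sum_divide_distrib)
    \<comment> \<open>normalise the weights to sum to one, then shrink towards the origin by the factor \<open>?t\<close>\<close>
    then have "?t *\<^sub>R (\<Sum>a\<in>A. (\<bar>lookup y a\<bar> / ?t) *\<^sub>R e a) + (1 - ?t) *\<^sub>R 0 \<in> ?C"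
      using t0 y by (intro convexD[OF convex_convex_hull] zero) auto
    then show ?thesis using False decomp by (simp add: scaleR_sum_right)
  qed
qed

section \<open>The ideal of the signed unit vectors\<close>

definition signed_units_generators :: "'v set \<Rightarrow> 'v mpoly set"
  where "signed_units_generators A =
    {Var a ^ 3 - Var a | a. a \<in> A} \<union> {Var a * Var b | a b. a \<in> A \<and> b \<in> A \<and> a \<noteq> b} \<union>
    {(\<Sum>a \<in> A. Var a ^ 2) - 1}"

definition signed_units_ideal :: "'v set \<Rightarrow> 'v mpoly set"
  where "signed_units_ideal A = Idl\<^bsub>mpoly_ring A\<^esub> (signed_units_generators A)"

lemma generators_carrier: "signed_units_generators A \<subseteq> carrier (mpoly_ring A)"
  unfolding signed_units_generators_def by blast

lemma ideal_signed_units: "ideal (signed_units_ideal A) (mpoly_ring A)"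
  unfolding signed_units_ideal_def
  by (rule ring.genideal_ideal[OF ring_mpoly_ring generators_carrier])

lemma generators_subset_ideal: "signed_units_generators A \<subseteq> signed_units_ideal A"
  unfolding signed_units_ideal_def
  by (rule ring.genideal_self[OF ring_mpoly_ring generators_carrier])

lemma signed_unit_in_variety:
  assumes "finite A" "a \<in> A" "s = 1 \<or> s = -1"
  shows "single a s \<in> real_variety A (signed_units_ideal A)"
  unfolding signed_units_ideal_def
proof (rule real_variety_genideal[OF generators_carrier])
  show "single a s \<in> points A" using assms by (auto simp: points_def)
next
  fix g assume "g \<in> signed_units_generators A"
  moreover have "(\<Sum>b\<in>A. (s when a = b)\<^sup>2) = (\<Sum>b\<in>A. if b = a then 1 else 0)"
    using assms by (intro sum.cong) (auto simp: when_def)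
  ultimately show "mpoly_eval (single a s) g = 0"
    using assms unfolding signed_units_generators_def
    by (auto simp: mpoly_eval_simps lookup_single when_def)
qed

text \<open>
  With \<open>L\<close> the signed sum, \<open>p\<^sup>2 - 2 * p = L\<^sup>2 - 1\<close>. Expanding \<open>L\<^sup>2\<close>, the diagonal gives
  \<open>\<Sum>a\<in>A. (Var a)\<^sup>2\<close> since the signs square to one, and subtracting \<open>1\<close> turns this into a generator;
  the off-diagonal terms are multiples of generators.
\<close>

lemma one_minus_signed_sum_square_congruence:
  fixes s :: "'v \<Rightarrow> real"
  assumes A: "finite A" and s: "\<And>a. a \<in> A \<Longrightarrow> s a = 1 \<or> s a = -1"
  defines "p \<equiv> 1 - (\<Sum>a\<in>A. s a *\<^sub>R Var a)"
  shows "p ^ 2 - 2 *\<^sub>R p \<in> signed_units_ideal A"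
proof -
  note I = ideal_signed_units[of A]
  let ?L = "\<Sum>a\<in>A. s a *\<^sub>R Var a :: 'v mpoly"
  have prod: "(s a *\<^sub>R Var a) * (s b *\<^sub>R Var b) = (s a * s b) *\<^sub>R (Var a * Var b :: 'v mpoly)" for a b
    by (simp add: scaleR_eq_mult mult_single flip: mult.assoc) (simp add: ac_simps mult_single)
  have "?L * ?L = (\<Sum>a\<in>A. \<Sum>b\<in>A. (s a * s b) *\<^sub>R (Var a * Var b))"
    by (simp add: sum_product prod)
  also have "\<dots> = (\<Sum>a\<in>A. Var a ^ 2 + (\<Sum>b\<in>A - {a}. (s a * s b) *\<^sub>R (Var a * Var b)))"
  proof (rule sum.cong[OF refl])
    fix a assume a: "a \<in> A"
    then have "s a * s a = 1" using s by fastforce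
    then show "(\<Sum>b\<in>A. (s a * s b) *\<^sub>R (Var a * Var b)) =
        Var a ^ 2 + (\<Sum>b\<in>A - {a}. (s a * s b) *\<^sub>R (Var a * Var b))"
      using sum.remove[OF A a, of "\<lambda>b. (s a * s b) *\<^sub>R (Var a * Var b)"]
      by (simp add: power2_eq_square)
  qed
  finally have LL: "?L * ?L - 1 = ((\<Sum>a\<in>A. Var a ^ 2) - 1) +
      (\<Sum>a\<in>A. \<Sum>b\<in>A - {a}. (s a * s b) *\<^sub>R (Var a * Var b))"
    by (simp add: sum.distrib)
  have "(\<Sum>a\<in>A. Var a ^ 2) - 1 \<in> signed_units_ideal A"
    using generators_subset_ideal by (auto simp: signed_units_generators_def)
  moreover have "Var a * Var b \<in> signed_units_ideal A" if "a \<in> A" "b \<in> A - {a}" for a b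
    using generators_subset_ideal[of A] that unfolding signed_units_generators_def by blast
  ultimately have "?L * ?L - 1 \<in> signed_units_ideal A"
    unfolding LL by (intro ideal_add[OF I] ideal_sum[OF I] ideal_scaleR[OF I])
  moreover have "p ^ 2 - 2 *\<^sub>R p = ?L * ?L - 1"
    by (simp add: p_def power2_eq_square algebra_simps scaleR_2)
  ultimately show ?thesis by simp
qed

text \<open>
  Apply a functional for \<open>y\<close> to \<open>(1 - L)\<^sup>2 \<equiv> 2 * (1 - L)\<close>, where the signs in \<open>L\<close> are those of
  the coordinates of \<open>y\<close>: then \<open>L\<close> is sent to \<open>\<Sum>a\<in>A. \<bar>lookup y a\<bar>\<close>, and the square to a
  nonnegative number.
\<close>

lemma theta_points_subset_cross_polytope:
  assumes A: "finite A" and y: "y \<in> theta_points A (signed_units_ideal A) 1"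
  shows "(\<Sum>a\<in>A. \<bar>lookup y a\<bar>) \<le> 1"
proof -
  note I = ideal_signed_units[of A]
  let ?R = "residue_class A (signed_units_ideal A)"
  obtain l where l: "l \<in> sos_dual A (signed_units_ideal A) 1" "l (?R 1) = 1"
    and ly: "\<And>a. a \<in> A \<Longrightarrow> lookup y a = l (?R (Var a))"
    using y by (auto simp: theta_points_def)
  have R: "?R f \<in> classes_upto A (signed_units_ideal A) (2 * 1)"
    if "f \<in> carrier (mpoly_ring A)" "tdegree f \<le> 1" for f
    using that by (intro residue_class_in_classes_upto[OF I]) auto
  have l_add: "l (?R (f + g)) = l (?R f) + l (?R g)"
    if "f \<in> carrier (mpoly_ring A)" "tdegree f \<le> 1" "g \<in> carrier (mpoly_ring A)" "tdegree g \<le> 1"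
    for f g
    using l(1) that R[of f] R[of g] by (simp add: sos_dual_def class_functional_def)
  have l_scale: "l (?R (c *\<^sub>R f)) = c * l (?R f)"
    if "f \<in> carrier (mpoly_ring A)" "tdegree f \<le> 1" for c f
    using l(1) that R[of f] by (simp add: sos_dual_def class_functional_def)
  have l_sum: "l (?R (\<Sum>a\<in>B. s a *\<^sub>R Var a)) = (\<Sum>a\<in>B. s a * lookup y a)"
    if "finite B" "B \<subseteq> A" for s :: "'a \<Rightarrow> real" and B
    using that
  proof induction
    case empty
    show ?case using l_scale[of 0 0] by (simp add: tdegree_0)
  next
    case (insert a B)
    then show ?case
      by (subst sum.insert)
        (auto simp: l_add l_scale ly tdegree_Var intro!: l_add[THEN trans] carrier_sum
          tdegree_sum_le tdegree_scaleR_le)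
  qed
  define s where "s a = (if lookup y a < 0 then -1 else 1 :: real)" for a
  define L where "L = (\<Sum>a\<in>A. s a *\<^sub>R Var a :: 'a mpoly)"
  have L: "L \<in> carrier (mpoly_ring A)" "tdegree L \<le> 1"
    unfolding L_def by (auto intro!: tdegree_sum_le tdegree_scaleR_le simp: tdegree_Var)
  define p where "p = 1 - L"
  \<comment> \<open>a functional is only known to respect sums and scalings, so the difference is written with these\<close>
  have p_eq: "p = 1 + (-1) *\<^sub>R L" by (simp add: p_def)
  have p: "p \<in> carrier (mpoly_ring A)" "tdegree p \<le> 1"
    unfolding p_eq using L
    by (intro carrier_add carrier_scaleR tdegree_add_le tdegree_scaleR_le; simp add: tdegree_1)+
  have "?R (\<Sum>i<Suc 0. p ^ 2) \<in> sos_classes A (signed_units_ideal A) 1"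
    unfolding sos_classes_def using p by (intro CollectI exI[of _ "Suc 0"] exI[of _ "\<lambda>_. p"]) auto
  then have "0 \<le> l (?R (p ^ 2))" using l(1) by (auto simp: sos_dual_def)
  also have "?R (p ^ 2) = ?R (2 *\<^sub>R p)"
    unfolding p_def L_def
    by (intro residue_class_eqI[OF I] one_minus_signed_sum_square_congruence A) (auto simp: s_def)
  also have "l \<dots> = 2 * l (?R p)" using p by (rule l_scale)
  also have "l (?R p) = l (?R 1) + l (?R ((-1) *\<^sub>R L))"
    unfolding p_eq using L by (intro l_add carrier_scaleR tdegree_scaleR_le) (simp_all add: tdegree_1)
  also have "l (?R 1) = 1" by (rule l(2))
  also have "l (?R ((-1) *\<^sub>R L)) = (-1) * l (?R L)" using L by (rule l_scale)
  also have "l (?R L) = (\<Sum>a\<in>A. s a * lookup y a)" unfolding L_def using A by (intro l_sum) auto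
  also have "\<dots> = (\<Sum>a\<in>A. \<bar>lookup y a\<bar>)" by (intro sum.cong) (auto simp: s_def)
  finally show ?thesis by simp
qed

lemma theta_exact_signed_units_ideal:
  assumes A: "finite A" "A \<noteq> {}"
  shows "theta_exact A (signed_units_ideal A) 1"
proof -
  let ?I = "signed_units_ideal A"
  have "theta_points A ?I 1 \<subseteq> convex hull (real_variety A ?I)"
  proof
    fix y assume y: "y \<in> theta_points A ?I 1"
    then have "y \<in> points A" by (simp add: theta_points_def)
    with A theta_points_subset_cross_polytope[OF A(1) y]
    show "y \<in> convex hull (real_variety A ?I)"
      by (intro cross_polytope_subset_convex_hull) (auto intro: signed_unit_in_variety)
  qed
  moreover have "convex hull (real_variety A ?I) \<subseteq> theta_points A ?I 1"
    by (intro hull_minimal real_variety_subset_theta_points ideal_signed_units convex_theta_points)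
  ultimately show ?thesis
    by (simp add: theta_exact_def theta_body_eq_closure subset_antisym)
qed

lemma finite_nonempty_tensor_index:
  assumes "\<forall>n\<in>set ns. n \<ge> 1"
  shows "finite (tensor_index ns) \<and> tensor_index ns \<noteq> {}"
  using assms
proof (induction ns)
  case Nil
  show ?case by (simp add: tensor_index_def)
next
  case (Cons n ns)
  have "tensor_index (n # ns) = (\<lambda>(i, is). i # is) ` ({1..n} \<times> tensor_index ns)"
    by (auto simp: tensor_index_def set_Cons_def)
  then show ?case using Cons by auto
qed

theorem proposition3p7:
  fixes d :: nat and ns :: "nat list"
  assumes "d \<ge> 1" and "length ns = d" and "\<forall>i<d. ns ! i \<ge> 1"
  shows "theta_exact (tensor_index ns) (I1 ns) 1"
proof -
  have "\<forall>n\<in>set ns. n \<ge> 1" using assms by (auto simp: in_set_conv_nth)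
  moreover have "I1 ns = signed_units_ideal (tensor_index ns)"
    by (simp add: I1_def signed_units_ideal_def signed_units_generators_def)
  ultimately show ?thesis
    using finite_nonempty_tensor_index theta_exact_signed_units_ideal by metis
qed

end
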